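(* For every $n\ge1$ and every permutation $w\in S_n$ avoiding the patterns $1432$ and $1423$, one has $c_w\ge 0$, where the integers $c_w$ ($w\in S_m$, $m\ge1$) are defined recursively by \[ c_w := \mathfrak{S}_w(\mathbf 1) - 1 - \sum_{u:\ |u|<|w|} c_u\, p_u(w), \] the sum ranging over permutations $u\in S_m$ with $1\le m<|w|$.
   Context: For $w\in S_m$ write $|w|=m$. $\mathfrak{S}_w(\mathbf 1)$ is the Schubert polynomial $\mathfrak{S}_w$ evaluated with all variables equal to $1$. $p_u(w)$ is the number of occurrences of $u$ as a pattern in $w$, i.e. the number of index sets $i_1<\dots<i_{|u|}$ such that $w(i_1)\cdots w(i_{|u|})$ has the same relative order as $u$. $w$ avoids a pattern $\pi$ if $p_\pi(w)=0$. *)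

theory Defs
  imports
    "HOL-Library.Poly_Mapping"
    "HOL-Combinatorics.Permutations"
begin

section \<open>Integer polynomials in the variables \<open>x 1, x 2, \<dots>\<close>\<close>

text \<open>Exponent vectors are finitely supported functions \<open>nat \<Rightarrow> nat\<close>, and a polynomial is a
  finitely supported function from exponent vectors to coefficients; multiplication is the
  convolution product of \<^theory>\<open>HOL-Library.Poly_Mapping\<close>, which makes this type an integral
  domain.\<close>

type_synonym ipoly = "(nat \<Rightarrow>\<^sub>0 nat) \<Rightarrow>\<^sub>0 int"

definition pvar :: "nat \<Rightarrow> ipoly" where
  "pvar i = Poly_Mapping.single (Poly_Mapping.single i 1) 1"

definition peval :: "(nat \<Rightarrow> int) \<Rightarrow> ipoly \<Rightarrow> int" where
  "peval a f = (\<Sum>e\<in>Poly_Mapping.keys f.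
     Poly_Mapping.lookup f e *
     (\<Prod>i\<in>Poly_Mapping.keys e. a i ^ Poly_Mapping.lookup e i))"

text \<open>\<open>Poly_Mapping.map_key\<close> precomposes with an injective map, here an involution, so it
  exchanges the exponents of the variables \<open>i\<close> and \<open>i + 1\<close>.\<close>

definition swap_vars :: "nat \<Rightarrow> ipoly \<Rightarrow> ipoly" where
  "swap_vars i f =
     Poly_Mapping.map_key (Poly_Mapping.map_key (transpose i (Suc i))) f"

text \<open>\<open>(f - s\<^sub>i f) / (x\<^sub>i - x\<^sub>i\<^sub>+\<^sub>1)\<close>; existence and uniqueness of the quotient
  are \<open>div_diff_ex1\<close> below.\<close>

definition div_diff :: "nat \<Rightarrow> ipoly \<Rightarrow> ipoly" where
  "div_diff i f = (THE q. (pvar i - pvar (Suc i)) * q = f - swap_vars i f)"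

lemma inj_map_key_transpose:
  "inj (Poly_Mapping.map_key (transpose i j) :: (nat \<Rightarrow>\<^sub>0 nat) \<Rightarrow> (nat \<Rightarrow>\<^sub>0 nat))"
proof (rule inj_on_inverseI)
  fix e :: "nat \<Rightarrow>\<^sub>0 nat"
  show "Poly_Mapping.map_key (transpose i j) (Poly_Mapping.map_key (transpose i j) e) = e"
    by (rule poly_mapping_eqI) (simp add: map_key.rep_eq inj_transpose)
qed

lemma swap_vars_diff_dvd: "pvar i - pvar (Suc i) dvd f - swap_vars i f"
proof (induction f rule: update_induct)
  case const
  then show ?case
    by (simp add: swap_vars_def inj_map_key_transpose)
next
  case (update f e c)
  let ?\<tau> = "transpose i (Suc i)"
  let ?T = "Poly_Mapping.map_key ?\<tau> :: (nat \<Rightarrow>\<^sub>0 nat) \<Rightarrow> (nat \<Rightarrow>\<^sub>0 nat)"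
  let ?s = "Poly_Mapping.single :: (nat \<Rightarrow>\<^sub>0 nat) \<Rightarrow> int \<Rightarrow> ipoly"
  have TT: "?T (?T d) = d" for d
    by (rule poly_mapping_eqI) (simp add: map_key.rep_eq inj_transpose)
  have upd: "Poly_Mapping.update e c f = f + ?s e c"
    using update
    by (intro poly_mapping_eqI)
       (auto simp: lookup_update lookup_add lookup_single in_keys_iff when_def)
  have swap_add: "swap_vars i (g + h) = swap_vars i g + swap_vars i h" for g h
    by (simp add: swap_vars_def inj_map_key_transpose map_key_plus)
  have swap_single: "swap_vars i (?s d c) = ?s (?T d) c" for d
    using map_key_single[OF inj_map_key_transpose, of i "Suc i" "?T d" c]
    by (simp add: swap_vars_def TT)
  have pow: "pvar k ^ n = ?s (Poly_Mapping.single k n) 1" for k n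
    by (induction n) (simp_all add: pvar_def mult_single flip: single_add)
  have ordered: "pvar i - pvar (Suc i) dvd ?s d c - ?s (?T d) c"
    if le: "Poly_Mapping.lookup d (Suc i) \<le> Poly_Mapping.lookup d i" for d
  proof -
    define b where "b = Poly_Mapping.lookup d (Suc i)"
    define n where "n = Poly_Mapping.lookup d i - b"
    define r where "r = Poly_Mapping.update i b d"
    have d: "d = r + Poly_Mapping.single i n"
      using le by (intro poly_mapping_eqI)
        (auto simp: r_def n_def b_def lookup_add lookup_update lookup_single when_def)
    have Td: "?T d = r + Poly_Mapping.single (Suc i) n"
      using le by (intro poly_mapping_eqI)
        (auto simp: r_def n_def b_def lookup_add lookup_update lookup_single when_def
          map_key.rep_eq inj_transpose transpose_def)
    have "?s d c - ?s (?T d) c = ?s r c * (pvar i ^ n - pvar (Suc i) ^ n)"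
      unfolding Td pow by (subst (1) d) (simp add: mult_single algebra_simps)
    moreover have "pvar i - pvar (Suc i) dvd pvar i ^ n - pvar (Suc i) ^ n"
      by (simp add: power_diff_sumr2)
    ultimately show ?thesis
      by (metis dvd_mult)
  qed
  have "pvar i - pvar (Suc i) dvd ?s e c - ?s (?T e) c"
  proof (cases "Poly_Mapping.lookup e (Suc i) \<le> Poly_Mapping.lookup e i")
    case True
    then show ?thesis by (rule ordered)
  next
    case False
    then have "pvar i - pvar (Suc i) dvd ?s (?T e) c - ?s (?T (?T e)) c"
      by (intro ordered) (simp add: map_key.rep_eq inj_transpose)
    then show ?thesis
      by (metis TT dvd_minus_iff minus_diff_eq)
  qed
  moreover have "Poly_Mapping.update e c f - swap_vars i (Poly_Mapping.update e c f) =
      (f - swap_vars i f) + (?s e c - ?s (?T e) c)"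
    unfolding upd swap_add swap_single by simp
  ultimately show ?case
    using update.IH by simp
qed

lemma div_diff_ex1: "\<exists>!q. (pvar i - pvar (Suc i)) * q = f - swap_vars i f"
proof -
  have "pvar i \<noteq> pvar (Suc i)"
    by (auto simp: pvar_def dest!: arg_cong[where f = Poly_Mapping.keys])
  moreover obtain q where "f - swap_vars i f = (pvar i - pvar (Suc i)) * q"
    using swap_vars_diff_dvd[of i f] by (auto elim: dvdE)
  ultimately show ?thesis
    by (intro ex1I[of _ q]) auto
qed


section \<open>Schubert polynomials\<close>

text \<open>A permutation in \<open>S\<^sub>n\<close> is a function \<open>w\<close> with \<open>w permutes {1..n}\<close>.
  Such a \<open>w\<close> without ascents is the longest element, whose Schubert polynomial is
  \<open>x\<^sub>1\<^sup>n\<^sup>-\<^sup>1 x\<^sub>2\<^sup>n\<^sup>-\<^sup>2 \<dots> x\<^sub>n\<^sub>-\<^sub>1\<close>; otherwise \<open>\<SS>\<^sub>w = \<partial>\<^sub>i \<SS>\<^sub>w\<^sub>s\<^sub>i\<close> for an ascent \<open>i\<close> of \<open>w\<close>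
  (that is, a descent of \<open>w s\<^sub>i\<close>). The value does not depend on which ascent is used, because
  divided differences satisfy the braid relations; the least one is taken.\<close>

function schubert :: "nat \<Rightarrow> (nat \<Rightarrow> nat) \<Rightarrow> ipoly" where
  "schubert n w =
     (if \<exists>i. 1 \<le> i \<and> i < n \<and> w i < w (Suc i)
      then let i = (LEAST i. 1 \<le> i \<and> i < n \<and> w i < w (Suc i))
           in div_diff i (schubert n (w \<circ> transpose i (Suc i)))
      else \<Prod>i = 1..n. pvar i ^ (n - i))"
  by pat_completeness auto
termination
proof (relation "measure (\<lambda>(n, w). card {(a, b). 1 \<le> a \<and> a < b \<and> b \<le> n \<and> w a < w b})")
  show "wf (measure (\<lambda>(n, w). card {(a, b). 1 \<le> a \<and> a < b \<and> b \<le> n \<and> w a < (w b :: nat)}))"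
    by simp
next
  fix n i :: nat and w :: "nat \<Rightarrow> nat"
  assume ex: "\<exists>i. 1 \<le> i \<and> i < n \<and> w i < w (Suc i)"
    and i_def: "i = (LEAST i. 1 \<le> i \<and> i < n \<and> w i < w (Suc i))"
  have i: "1 \<le> i" "i < n" "w i < w (Suc i)"
    using LeastI_ex[OF ex] unfolding i_def by auto
  let ?\<tau> = "transpose i (Suc i)"
  let ?A = "\<lambda>v :: nat \<Rightarrow> nat. {(a, b). 1 \<le> a \<and> a < b \<and> b \<le> n \<and> v a < v b}"
  have fin: "finite (?A w)"
    by (rule finite_subset[of _ "{1..n} \<times> {1..n}"]) auto
  have "card (?A (w \<circ> ?\<tau>)) = card (map_prod ?\<tau> ?\<tau> ` ?A (w \<circ> ?\<tau>))"
    by (intro card_image[symmetric] inj_on_subset[OF prod.inj_map]) (auto simp: inj_transpose)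
  also have "\<dots> \<le> card (?A w - {(i, Suc i)})"
    using i fin by (intro card_mono) (auto simp: transpose_def split: if_splits)
  also have "\<dots> < card (?A w)"
    using i fin by (intro card_Diff1_less) auto
  finally show "((n, w \<circ> ?\<tau>), (n, w)) \<in>
      measure (\<lambda>(n, w). card {(a, b). 1 \<le> a \<and> a < b \<and> b \<le> n \<and> w a < w b})"
    by simp
qed

declare schubert.simps [simp del]


section \<open>Pattern containment\<close>

definition pattern_count :: "nat \<Rightarrow> (nat \<Rightarrow> nat) \<Rightarrow> nat \<Rightarrow> (nat \<Rightarrow> nat) \<Rightarrow> nat" where
  "pattern_count m u n w = card {I. I \<subseteq> {1..n} \<and>
     (\<exists>f. strict_mono_on {1..m} f \<and> f ` {1..m} = I \<and>
       (\<forall>a\<in>{1..m}. \<forall>b\<in>{1..m}. w (f a) < w (f b) \<longleftrightarrow> u a < u b))}"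

definition one_line :: "nat list \<Rightarrow> nat \<Rightarrow> nat" where
  "one_line xs i = (if i \<in> {1..length xs} then xs ! (i - 1) else i)"

definition avoids :: "nat \<Rightarrow> (nat \<Rightarrow> nat) \<Rightarrow> nat list \<Rightarrow> bool" where
  "avoids n w xs \<longleftrightarrow> pattern_count (length xs) (one_line xs) n w = 0"


section \<open>The numbers \<open>c\<^sub>w\<close>\<close>

text \<open>The size \<open>n\<close> is an explicit argument: the same function \<open>w\<close> seen in \<open>S\<^sub>n\<close> and in
  \<open>S\<^sub>n\<^sub>+\<^sub>1\<close> (fixing \<open>n + 1\<close>) gives two different permutations here.\<close>

function c_coeff :: "nat \<Rightarrow> (nat \<Rightarrow> nat) \<Rightarrow> int" where
  "c_coeff n w = peval (\<lambda>_. 1) (schubert n w) - 1 -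
     (\<Sum>m\<in>{1..<n}. \<Sum>u | u permutes {1..m}. c_coeff m u * int (pattern_count m u n w))"
  by pat_completeness auto
termination by (relation "measure fst") auto

declare c_coeff.simps [simp del]

end

theory Submission
  imports Defs "HOL-Library.Infinite_Set"
begin

text \<open>Avoiding both patterns means that at the first ascent \<open>i\<close> of \<open>w\<close> at most one column of the Rothe
  diagram has a box in row \<open>i + 1\<close> but none in row \<open>i\<close>. Hence the divided difference recursion acts on
  one factor at a time, and \<open>\<SS>\<^sub>w\<close> is a product over the columns: the factor of a column \<open>D\<close> is the sum
  of \<open>\<Prod>\<^sub>k\<^sub>\<in>\<^sub>R x\<^sub>k\<close> over all \<open>R\<close> obtained by moving the boxes of \<open>D\<close> upwards. So \<open>\<SS>\<^sub>w(1)\<close> counts the ways to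
  move boxes upwards in all columns. Recording such a choice by the set \<open>S\<close> of pairs (row, column) in
  which it differs from the diagram, the choices whose \<open>S\<close> only involves positions in \<open>I\<close> are exactly
  those of the pattern of \<open>w\<close> at \<open>I\<close>. By inclusion-exclusion \<open>c\<^sub>w\<close> is the number of choices that involve
  every position.\<close>

section \<open>Variable exchange and evaluation at 1\<close>

text \<open>Setting a coefficient outside the support amounts to adding a monomial, so statements
  that are additive in \<open>f\<close> reduce to single monomials.\<close>

lemma poly_mapping_monom_induct [case_names zero add]:
  fixes f :: "'a \<Rightarrow>\<^sub>0 'b::comm_monoid_add"
  assumes zero: "P 0" and add: "\<And>f e c. P f \<Longrightarrow> P (f + Poly_Mapping.single e c)"
  shows "P f"
proof (induction f rule: update_induct)
  case const
  show ?case by (rule zero)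
next
  case (update f e c)
  have "Poly_Mapping.update e c f = f + Poly_Mapping.single e c"
    using update
    by (intro poly_mapping_eqI)
       (auto simp: lookup_update lookup_add lookup_single in_keys_iff when_def)
  then show ?case
    using add[OF update.IH] by simp
qed

abbreviation swap_exps :: "nat \<Rightarrow> (nat \<Rightarrow>\<^sub>0 nat) \<Rightarrow> (nat \<Rightarrow>\<^sub>0 nat)" where
  "swap_exps i \<equiv> Poly_Mapping.map_key (transpose i (Suc i))"

lemma swap_exps_swap_exps: "swap_exps i (swap_exps i e) = e"
  by (rule poly_mapping_eqI) (simp add: map_key.rep_eq inj_transpose)

lemma swap_vars_0 [simp]: "swap_vars i 0 = 0"
  by (simp add: swap_vars_def inj_map_key_transpose)

lemma swap_vars_add [simp]: "swap_vars i (f + g) = swap_vars i f + swap_vars i g"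
  by (simp add: swap_vars_def inj_map_key_transpose map_key_plus)

lemma swap_vars_single:
  "swap_vars i (Poly_Mapping.single e c) = Poly_Mapping.single (swap_exps i e) c"
  using map_key_single[OF inj_map_key_transpose, of i "Suc i" "swap_exps i e" c]
  by (simp add: swap_vars_def swap_exps_swap_exps)

lemma swap_vars_mult [simp]: "swap_vars i (f * g) = swap_vars i f * swap_vars i g"
proof (induction f rule: poly_mapping_monom_induct)
  case (add f e c)
  have "swap_vars i (Poly_Mapping.single e c * g) =
      swap_vars i (Poly_Mapping.single e c) * swap_vars i g"
    by (induction g rule: poly_mapping_monom_induct)
       (simp_all add: distrib_left mult_single swap_vars_single map_key_plus inj_transpose)
  then show ?case
    by (simp add: add distrib_right)
qed simp

lemma swap_vars_1 [simp]: "swap_vars i 1 = 1"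
  by (simp add: swap_vars_single inj_transpose flip: single_one)

lemma swap_vars_diff [simp]: "swap_vars i (f - g) = swap_vars i f - swap_vars i g"
  by (metis add_diff_cancel_right' diff_add_cancel swap_vars_add)

lemma swap_vars_pvar [simp]: "swap_vars i (pvar k) = pvar (transpose i (Suc i) k)"
  using map_key_single[of "transpose i (Suc i)" "transpose i (Suc i) k" "1::nat"]
  by (simp add: pvar_def swap_vars_single inj_transpose)

lemma swap_vars_sum [simp]: "swap_vars i (sum f A) = (\<Sum>a\<in>A. swap_vars i (f a))"
  by (induction A rule: infinite_finite_induct) simp_all

lemma swap_vars_prod [simp]: "swap_vars i (prod f A) = (\<Prod>a\<in>A. swap_vars i (f a))"
  by (induction A rule: infinite_finite_induct) simp_all

lemma div_diff_eqI: "f - swap_vars i f = (pvar i - pvar (Suc i)) * q \<Longrightarrow> div_diff i f = q"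
  unfolding div_diff_def by (intro the1_equality div_diff_ex1) simp

text \<open>Factors symmetric in the variables \<open>i\<close> and \<open>Suc i\<close> behave as
  constants for \<open>div_diff i\<close>. This confines the recursion to one column factor.\<close>

lemma div_diff_mult_symmetric:
  assumes "swap_vars i g = g"
  shows "div_diff i (f * g) = div_diff i f * g"
proof (rule div_diff_eqI)
  have "(pvar i - pvar (Suc i)) * div_diff i f = f - swap_vars i f"
    unfolding div_diff_def by (rule theI'[OF div_diff_ex1])
  then show "f * g - swap_vars i (f * g) = (pvar i - pvar (Suc i)) * (div_diff i f * g)"
    using assms by (simp add: left_diff_distrib flip: mult.assoc)
qed

text \<open>Unlike the support of \<open>f\<close>, the set of all exponent vectors does not depend
  on \<open>f\<close>, which makes additivity immediate.\<close>

lemma peval_one: "peval (\<lambda>_. 1) f = (\<Sum>e. Poly_Mapping.lookup f e)"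
proof -
  have "peval (\<lambda>_. 1) f = (\<Sum>e\<in>Poly_Mapping.keys f. Poly_Mapping.lookup f e)"
    by (simp add: peval_def)
  also have "\<dots> = (\<Sum>e. Poly_Mapping.lookup f e)"
    by (rule Sum_any.expand_superset[symmetric]) (auto simp: in_keys_iff)
  finally show ?thesis .
qed

lemma peval_one_single: "peval (\<lambda>_. 1) (Poly_Mapping.single e c) = c"
  by (simp add: peval_def)

lemma peval_one_add: "peval (\<lambda>_. 1) (f + g) = peval (\<lambda>_. 1) f + peval (\<lambda>_. 1) g"
  by (simp add: peval_one lookup_add Sum_any.distrib)

lemma peval_one_mult: "peval (\<lambda>_. 1) (f * g) = peval (\<lambda>_. 1) f * peval (\<lambda>_. 1) g"
proof (induction f rule: poly_mapping_monom_induct)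
  case (add f e c)
  have "peval (\<lambda>_. 1) (Poly_Mapping.single e c * g) = c * peval (\<lambda>_. 1) g"
    by (induction g rule: poly_mapping_monom_induct)
       (simp_all add: distrib_left mult_single peval_one_add peval_one_single, simp add: peval_def)
  then show ?case
    by (simp add: add distrib_right peval_one_add peval_one_single)
qed (simp add: peval_def)

lemma peval_one_pvar: "peval (\<lambda>_. 1) (pvar i) = 1"
  by (simp add: pvar_def peval_one_single)

lemma peval_one_1: "peval (\<lambda>_. 1) 1 = 1"
  by (simp add: peval_one_single flip: single_one)

lemma peval_one_sum: "peval (\<lambda>_. 1) (sum f A) = (\<Sum>a\<in>A. peval (\<lambda>_. 1) (f a))"
  by (induction A rule: infinite_finite_induct) (simp_all add: peval_one_add, simp_all add: peval_def)

lemma peval_one_prod: "peval (\<lambda>_. 1) (prod f A) = (\<Prod>a\<in>A. peval (\<lambda>_. 1) (f a))"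
  by (induction A rule: infinite_finite_induct) (simp_all add: peval_one_mult peval_one_1)


section \<open>The polynomial of a single column\<close>

text \<open>For finite sets this is the componentwise order: the r-th smallest element of
  \<open>R\<close> is at most the r-th smallest element of \<open>D\<close>.\<close>

definition dominates :: "nat set \<Rightarrow> nat set \<Rightarrow> bool" where
  "dominates R D \<longleftrightarrow> card R = card D \<and> (\<forall>p. card (D \<inter> {..p}) \<le> card (R \<inter> {..p}))"

text \<open>For \<open>D\<close> inside \<open>{1..n}\<close> this is the key polynomial of the 0/1
  indicator vector of \<open>D\<close>.\<close>

definition column_poly :: "nat \<Rightarrow> nat set \<Rightarrow> ipoly" where
  "column_poly n D = (\<Sum>R | R \<subseteq> {1..n} \<and> dominates R D. \<Prod>k\<in>R. pvar k)"

lemma card_Int_atMost_Suc: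
  "card (X \<inter> {..Suc p}) = card (X \<inter> {..p}) + (if Suc p \<in> X then 1 else 0)"
  by (simp add: atMost_Suc)

lemma inj_on_transpose: "inj_on (transpose i j) X"
  by (rule inj_on_subset[OF inj_transpose]) simp

lemma card_transpose_image [simp]: "card (transpose i j ` X) = card X"
  by (rule card_image[OF inj_on_transpose])

lemma card_transpose_Int_atMost:
  assumes "p \<noteq> i"
  shows "card (transpose i (Suc i) ` X \<inter> {..p}) = card (X \<inter> {..p})"
proof -
  have "transpose i (Suc i) ` X \<inter> {..p} = transpose i (Suc i) ` (X \<inter> {..p})"
  proof -
    have "transpose i (Suc i) k \<le> p \<longleftrightarrow> k \<le> p" for k
      using assms by (auto simp: transpose_def)
    then show ?thesis by auto
  qed
  then show ?thesis
    by simp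
qed

text \<open>The exchange affects only the prefix count at \<open>i\<close>. If \<open>i\<close> is
  not in \<open>D\<close>, the bound there follows from the one at \<open>i - 1\<close>; if
  \<open>i\<close> and \<open>Suc i\<close> are both in \<open>D\<close>, it follows from the one at
  \<open>Suc i\<close>.\<close>

lemma dominates_transpose:
  assumes R: "dominates R D" and i: "1 \<le> i" and D: "i \<in> D \<longrightarrow> Suc i \<in> D"
  shows "dominates (transpose i (Suc i) ` R) D"
  unfolding dominates_def
proof (intro conjI allI)
  let ?\<tau> = "transpose i (Suc i)"
  show "card (?\<tau> ` R) = card D"
    using R by (simp add: dominates_def)
  fix p
  show "card (D \<inter> {..p}) \<le> card (?\<tau> ` R \<inter> {..p})"
  proof (cases "p = i")
    case False
    then show ?thesis
      using R by (simp add: dominates_def card_transpose_Int_atMost)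
  next
    case True
    obtain i0 where i0: "i = Suc i0"
      using i by (cases i) auto
    have "card (D \<inter> {..i0}) \<le> card (?\<tau> ` R \<inter> {..i0})"
        "card (D \<inter> {..Suc i}) \<le> card (?\<tau> ` R \<inter> {..Suc i})"
      using R by (simp_all add: dominates_def card_transpose_Int_atMost i0)
    then show ?thesis
      using D unfolding True i0 card_Int_atMost_Suc by (auto split: if_splits)
  qed
qed

lemma transpose_image_subset:
  assumes "1 \<le> i" "i < n" "R \<subseteq> {1..n}"
  shows "transpose i (Suc i) ` R \<subseteq> {1..n}"
  using assms by (force simp: transpose_def)

text \<open>Exchanging the rows \<open>i\<close> and \<open>Suc i\<close> is an involution on the
  sets that index the sum.\<close>

lemma swap_vars_column_poly:
  assumes i: "1 \<le> i" "i < n" and D: "i \<in> D \<longrightarrow> Suc i \<in> D"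
  shows "swap_vars i (column_poly n D) = column_poly n D"
proof -
  let ?\<tau> = "transpose i (Suc i)"
  let ?\<R> = "{R. R \<subseteq> {1..n} \<and> dominates R D}"
  have "swap_vars i (column_poly n D) = (\<Sum>R\<in>?\<R>. \<Prod>k\<in>?\<tau> ` R. pvar k)"
    by (simp add: column_poly_def prod.reindex inj_on_transpose comp_def)
  also have "\<dots> = (\<Sum>R\<in>?\<R>. \<Prod>k\<in>R. pvar k)"
    by (rule sum.reindex_bij_witness[where i = "image ?\<tau>" and j = "image ?\<tau>"])
       (use i D dominates_transpose transpose_image_subset in \<open>auto simp: image_image\<close>)
  finally show ?thesis
    by (simp add: column_poly_def)
qed

text \<open>\<open>column_poly n D\<close> is symmetric in the two variables and exceeds the
  polynomial of the raised column by a sum \<open>E\<close> for which \<open>pvar i * E\<close> is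
  symmetric too. Hence replacing the raised column by \<open>D\<close> does not change the divided
  difference, and the factor \<open>pvar i\<close> contributes 1.\<close>

lemma div_diff_column_poly:
  assumes i: "1 \<le> i" "i < n" and D: "i \<notin> D" "Suc i \<in> D"
  shows "div_diff i (pvar i * column_poly n (transpose i (Suc i) ` D)) = column_poly n D"
proof (rule div_diff_eqI)
  let ?\<tau> = "transpose i (Suc i)"
  let ?D' = "?\<tau> ` D"
  let ?\<R> = "\<lambda>D. {R. R \<subseteq> {1..n} \<and> dominates R D}"
  obtain i0 where i0: "i = Suc i0"
    using i by (cases i) auto
  have D': "i \<in> ?D'" "Suc i \<notin> ?D'"
    using D by (auto simp: transpose_def image_iff split: if_splits)
  have card_D': "card ?D' = card D"
    by simp
  \<comment> \<open>Moving the box from row \<open>Suc i\<close> to row \<open>i\<close> increases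
    the prefix count at \<open>i\<close> and no other.\<close>
  have cnt: "card (?D' \<inter> {..p}) = card (D \<inter> {..p}) + (if p = i then 1 else 0)" for p
  proof (cases "p = i")
    case True
    have "card (?D' \<inter> {..i0}) = card (D \<inter> {..i0})"
      by (rule card_transpose_Int_atMost) (simp add: i0)
    then show ?thesis
      using D D' unfolding True i0 card_Int_atMost_Suc by simp
  qed (simp add: card_transpose_Int_atMost)
  have sub: "?\<R> ?D' \<subseteq> ?\<R> D"
    unfolding dominates_def cnt card_D' by (auto intro: add_leD1)
  define E where "E = (\<Sum>R\<in>?\<R> D - ?\<R> ?D'. \<Prod>k\<in>R. pvar k)"
  have split: "column_poly n D = column_poly n ?D' + E"
  proof -
    have "finite (?\<R> D)"
      by (rule finite_subset[of _ "Pow {1..n}"]) auto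
    then show ?thesis
      unfolding column_poly_def E_def using sum.subset_diff[OF sub] by (simp add: add.commute)
  qed
  have "swap_vars i (pvar i * E) = pvar i * E"
  proof -
    have "swap_vars i (pvar i * (\<Prod>k\<in>R. pvar k)) = pvar i * (\<Prod>k\<in>R. pvar k)"
      if R: "R \<in> ?\<R> D - ?\<R> ?D'" for R
    proof -
      have fin: "finite R"
        using R by (auto intro: finite_subset)
      have "\<exists>p. \<not> card (?D' \<inter> {..p}) \<le> card (R \<inter> {..p})"
        using R card_D' by (auto simp: dominates_def)
      moreover have "card (D \<inter> {..p}) \<le> card (R \<inter> {..p})" for p
        using R by (auto simp: dominates_def)
      \<comment> \<open>\<open>R\<close> can violate the bound for \<open>?D'\<close> only at
        \<open>i\<close>, so it meets the bound for \<open>D\<close> there with equality. Comparison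
        with the prefixes at \<open>i - 1\<close> and \<open>Suc i\<close> then forces a box in row
        \<open>Suc i\<close> and none in row \<open>i\<close>, so \<open>pvar i\<close> times its
        monomial contains both variables exactly once.\<close>
      ultimately have "card (R \<inter> {..i}) \<le> card (D \<inter> {..i})"
          "card (D \<inter> {..i0}) \<le> card (R \<inter> {..i0})" "card (D \<inter> {..Suc i}) \<le> card (R \<inter> {..Suc i})"
        unfolding cnt by (auto simp: not_le less_Suc_eq_le split: if_splits) (metis leD)
      then have "i \<notin> R" "Suc i \<in> R"
        using D unfolding i0 card_Int_atMost_Suc by (auto split: if_splits)
      then have "(\<Prod>k\<in>R. pvar k) = pvar (Suc i) * (\<Prod>k\<in>R - {Suc i}. pvar k)"
          and "(\<Prod>k\<in>R - {Suc i}. pvar (?\<tau> k)) = (\<Prod>k\<in>R - {Suc i}. pvar k)"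
        using fin by (auto simp: prod.remove transpose_def intro!: prod.cong split: if_splits)
      then show ?thesis
        by (simp add: mult.left_commute)
    qed
    then show ?thesis
      by (simp add: E_def sum_distrib_left del: swap_vars_mult swap_vars_prod)
  qed
  moreover have "swap_vars i (column_poly n D) = column_poly n D"
    using i D by (intro swap_vars_column_poly) auto
  moreover have "pvar i * column_poly n ?D' = pvar i * column_poly n D - pvar i * E"
    by (simp add: split algebra_simps)
  ultimately show "pvar i * column_poly n ?D' - swap_vars i (pvar i * column_poly n ?D') =
      (pvar i - pvar (Suc i)) * column_poly n D"
    by (simp only: swap_vars_diff) (simp add: algebra_simps)
qed

text \<open>Boxes filling the top rows cannot move up, so the sum has a single term.\<close>

lemma column_poly_initial:
  assumes "j \<le> n"
  shows "column_poly n {1..j} = (\<Prod>k\<in>{1..j}. pvar k)"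
proof -
  have "{R. R \<subseteq> {1..n} \<and> dominates R {1..j}} = {{1..j}}"
  proof (intro equalityI subsetI)
    fix R assume R: "R \<in> {R. R \<subseteq> {1..n} \<and> dominates R {1..j}}"
    have fin: "finite R"
      using R by (auto intro: finite_subset)
    have "card {1..j} \<le> card (R \<inter> {..j})"
    proof -
      have "{1..j} \<inter> {..j} = {1..j}"
        by auto
      then show ?thesis
        using R unfolding dominates_def by (metis (mono_tags, lifting) mem_Collect_eq)
    qed
    then have "R \<inter> {..j} = R"
      using R fin by (intro card_subset_eq) (auto simp: dominates_def intro!: antisym card_mono)
    then have "R \<subseteq> {1..j}"
      using R by fastforce
    then have "R = {1..j}"
      using R by (intro card_subset_eq) (auto simp: dominates_def)
    then show "R \<in> {{1..j}}" by simp
  qed (use assms in \<open>auto simp: dominates_def\<close>)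
  then show ?thesis
    by (simp add: column_poly_def)
qed


section \<open>Factorization over the columns of the diagram\<close>

text \<open>Leaving the order of \<open>w c\<close> and \<open>w d\<close> open merges both patterns
  into one condition.\<close>

definition avoids_1432_1423 :: "nat \<Rightarrow> (nat \<Rightarrow> nat) \<Rightarrow> bool" where
  "avoids_1432_1423 n w \<longleftrightarrow> (\<forall>a b c d. 1 \<le> a \<and> a < b \<and> b < c \<and> c < d \<and> d \<le> n \<longrightarrow>
     \<not> (w a < w c \<and> w a < w d \<and> w c < w b \<and> w d < w b))"

text \<open>Columns of the Rothe diagram are indexed by positions \<open>j\<close> rather than by values \<open>w j\<close>.\<close>

definition diagram_column :: "(nat \<Rightarrow> nat) \<Rightarrow> nat \<Rightarrow> nat set" where
  "diagram_column w j = {k. 1 \<le> k \<and> k < j \<and> w j < w k}"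

lemma decreasing_before_first_ascent:
  fixes w :: "nat \<Rightarrow> nat"
  assumes "inj w" and step: "\<And>k. 1 \<le> k \<Longrightarrow> k < m \<Longrightarrow> \<not> w k < w (Suc k)"
    and "1 \<le> a" "a < b" "b \<le> m"
  shows "w b < w a"
  using \<open>a < b\<close> \<open>b \<le> m\<close>
proof (induction b)
  case (Suc b)
  have "w (Suc b) \<noteq> w b"
    using \<open>inj w\<close> by (simp add: inj_eq)
  then have "w (Suc b) < w b"
    using step[of b] Suc.prems \<open>1 \<le> a\<close> by simp
  then show ?case
    using Suc by (cases "a = b") auto
qed simp

lemma transpose_image_eq:
  assumes "i \<in> X \<longleftrightarrow> Suc i \<in> X"
  shows "transpose i (Suc i) ` X = X"
  using assms by (auto simp: transpose_def image_iff)

lemma mem_transpose_image: "k \<in> transpose i j ` X \<longleftrightarrow> transpose i j k \<in> X"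
  by (metis image_iff transpose_involutory)

text \<open>Row \<open>i\<close> meets the columns with \<open>j > i\<close>, of which there are
  \<open>n - i\<close>. This identifies the monomial at which \<open>schubert\<close> stops as a
  product over full columns.\<close>

lemma prod_column_initial:
  "(\<Prod>j\<in>{1..n}. \<Prod>k\<in>{1..j - 1}. pvar k) = (\<Prod>i = 1..n. pvar i ^ (n - i))"
proof (induction n)
  case (Suc n)
  have "(\<Prod>i = 1..Suc n. pvar i ^ (Suc n - i)) = (\<Prod>i = 1..n. pvar i ^ (Suc n - i))"
    by simp
  also have "\<dots> = (\<Prod>i = 1..n. pvar i ^ (n - i) * pvar i)"
    by (intro prod.cong refl) (simp add: Suc_diff_le mult.commute)
  finally show ?case
    using Suc by (simp add: prod.distrib)
qed simp

text \<open>The case \<open>j = i\<close> is excluded because that column moves to position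
  \<open>Suc i\<close> and gains a box in row \<open>i\<close>.\<close>

lemma diagram_column_transpose:
  assumes "j \<noteq> i" "w i < w (Suc i)" "1 \<le> i"
  shows "diagram_column (w \<circ> transpose i (Suc i)) (transpose i (Suc i) j) =
    transpose i (Suc i) ` diagram_column w j"
proof (rule set_eqI)
  fix k
  show "k \<in> diagram_column (w \<circ> transpose i (Suc i)) (transpose i (Suc i) j) \<longleftrightarrow>
      k \<in> transpose i (Suc i) ` diagram_column w j"
    unfolding mem_transpose_image using assms
    by (auto simp: diagram_column_def transpose_def)
qed

text \<open>The exchange carries an occurrence back to \<open>w\<close> unless \<open>i\<close> and
  \<open>Suc i\<close> are consecutive entries of it. As the first two they contradict the ascent;
  as later ones they put \<open>a\<close> left of \<open>i\<close> with \<open>w a < w i\<close>,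
  which \<open>dec\<close> rules out. This is where the choice of the first ascent matters.\<close>

lemma avoids_1432_1423_transpose:
  assumes av: "avoids_1432_1423 n w" and i: "1 \<le> i" "i < n"
    and dec: "\<And>k. 1 \<le> k \<Longrightarrow> k < i \<Longrightarrow> w i < w k" and asc: "w i < w (Suc i)"
  shows "avoids_1432_1423 n (w \<circ> transpose i (Suc i))"
  unfolding avoids_1432_1423_def
proof (intro allI impI notI)
  let ?\<tau> = "transpose i (Suc i)"
  fix a b c d
  assume ord: "1 \<le> a \<and> a < b \<and> b < c \<and> c < d \<and> d \<le> n"
  assume pat: "(w \<circ> ?\<tau>) a < (w \<circ> ?\<tau>) c \<and> (w \<circ> ?\<tau>) a < (w \<circ> ?\<tau>) d \<and>
    (w \<circ> ?\<tau>) c < (w \<circ> ?\<tau>) b \<and> (w \<circ> ?\<tau>) d < (w \<circ> ?\<tau>) b"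
  have mono: "?\<tau> x < ?\<tau> y" if "x < y" "\<not> (x = i \<and> y = Suc i)" for x y
    using that by (auto simp: transpose_def)
  have no_a: "\<not> (a = i \<and> b = Suc i)"
    using asc pat by auto
  have "\<not> (1 \<le> a \<and> a < i \<and> w a < w i)"
    using dec by (meson less_asym)
  then have no_bc: "\<not> (b = i \<and> c = Suc i)" and no_cd: "\<not> (c = i \<and> d = Suc i)"
    using ord pat by (auto simp: transpose_def split: if_splits)
  have "1 \<le> ?\<tau> a" "?\<tau> d \<le> n"
    using ord i by (auto simp: transpose_def)
  moreover have "?\<tau> a < ?\<tau> b" "?\<tau> b < ?\<tau> c" "?\<tau> c < ?\<tau> d"
    using ord no_a no_bc no_cd by (simp_all add: mono)
  ultimately show False
    using av[unfolded avoids_1432_1423_def, rule_format, of "?\<tau> a" "?\<tau> b" "?\<tau> c" "?\<tau> d"] pat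
    by simp
qed

lemma div_diff_pvar: "div_diff i (pvar i) = 1"
  by (rule div_diff_eqI) simp

text \<open>At the first ascent \<open>i\<close>, the exchange adds one factor \<open>pvar i\<close>
  and moves a box from row \<open>Suc i\<close> to row \<open>i\<close> in at most one column;
  \<open>div_diff i\<close> undoes both.\<close>

theorem schubert_eq_prod_column_poly:
  assumes "inj w" "avoids_1432_1423 n w"
  shows "schubert n w = (\<Prod>j\<in>{1..n}. column_poly n (diagram_column w j))"
  using assms
proof (induction n w rule: schubert.induct)
  case (1 n w)
  show ?case
  proof (cases "\<exists>i. 1 \<le> i \<and> i < n \<and> w i < w (Suc i)")
    case False
    have "diagram_column w j = {1..j - 1}" if "j \<in> {1..n}" for j
    proof -
      have "w j < w k" if "1 \<le> k" "k < j" for k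
        using decreasing_before_first_ascent[OF \<open>inj w\<close>, of n k j] False that \<open>j \<in> {1..n}\<close> by auto
      then show ?thesis
        by (auto simp: diagram_column_def)
    qed
    then have "(\<Prod>j\<in>{1..n}. column_poly n (diagram_column w j)) =
        (\<Prod>j\<in>{1..n}. \<Prod>k\<in>{1..j - 1}. pvar k)"
      by (intro prod.cong refl) (auto simp del: One_nat_def intro!: column_poly_initial)
    also have "\<dots> = schubert n w"
      unfolding schubert.simps[of n w] if_not_P[OF False] by (rule prod_column_initial)
    finally show ?thesis ..
  next
    case True
    define i where "i = (LEAST i. 1 \<le> i \<and> i < n \<and> w i < w (Suc i))"
    have i: "1 \<le> i" "i < n" "w i < w (Suc i)"
      using LeastI_ex[OF True] unfolding i_def by auto
    have "\<not> w k < w (Suc k)" if "1 \<le> k" "k < i" for k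
      using not_less_Least[of k "\<lambda>i. 1 \<le> i \<and> i < n \<and> w i < w (Suc i)"] that i
      unfolding i_def[symmetric] by simp
    then have dec: "w i < w k" if "1 \<le> k" "k < i" for k
      using decreasing_before_first_ascent[OF \<open>inj w\<close>, of i k i] that by simp
    let ?\<tau> = "transpose i (Suc i)"
    let ?C = "\<lambda>j. column_poly n (diagram_column w j)"
    \<comment> \<open>This column occupies all rows above \<open>i\<close>; at its new position it
      is still full, with one more box. Its polynomial thereby acquires the extra factor
      \<open>pvar i\<close>.\<close>
    have "diagram_column w i = {1..i - 1}"
      using dec by (auto simp: diagram_column_def)
    moreover have "column_poly n {1..i} = pvar i * column_poly n {1..i - 1}"
    proof -
      have "column_poly n {1..i - 1} = (\<Prod>k\<in>{1..i - 1}. pvar k)"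
        using i by (intro column_poly_initial) simp
      moreover have "{1..i} = insert i {1..i - 1}"
        using i by auto
      ultimately show ?thesis
        using column_poly_initial[of i n] i by simp
    qed
    moreover have "diagram_column (w \<circ> ?\<tau>) (Suc i) = {1..i}"
      using dec i by (auto simp: diagram_column_def transpose_def)
    ultimately have col_i: "column_poly n (diagram_column (w \<circ> ?\<tau>) (?\<tau> i)) = pvar i * ?C i"
      by simp
    \<comment> \<open>A later value below \<open>w i\<close> is also below \<open>w (Suc i)\<close>.
      So no column has a box in row \<open>i\<close> without one in row \<open>Suc i\<close>, and
      every factor \<open>?C j\<close> is symmetric.\<close>
    have nested: "i \<in> diagram_column w j \<Longrightarrow> Suc i \<in> diagram_column w j" for j
      using i by (cases "j = Suc i") (auto simp: diagram_column_def)
    have sym: "swap_vars i (?C j) = ?C j" for j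
      using swap_vars_column_poly[OF i(1,2)] nested by blast
    have col_eq: "column_poly n (?\<tau> ` diagram_column w j) = ?C j"
      if "Suc i \<in> diagram_column w j \<longrightarrow> i \<in> diagram_column w j" for j
      using that nested by (subst transpose_image_eq) auto
    have IH: "schubert n (w \<circ> ?\<tau>) =
        pvar i * ?C i * (\<Prod>j\<in>{1..n} - {i}. column_poly n (?\<tau> ` diagram_column w j))"
    proof -
      have "schubert n (w \<circ> ?\<tau>) = (\<Prod>j\<in>{1..n}. column_poly n (diagram_column (w \<circ> ?\<tau>) j))"
      proof (rule "1.IH"[OF True i_def])
        show "inj (w \<circ> ?\<tau>)"
          by (intro inj_compose \<open>inj w\<close> inj_transpose)
        show "avoids_1432_1423 n (w \<circ> ?\<tau>)"
          by (rule avoids_1432_1423_transpose[OF 1(3) i(1,2) dec i(3)])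
      qed
      also have "\<dots> = (\<Prod>j\<in>{1..n}. column_poly n (diagram_column (w \<circ> ?\<tau>) (?\<tau> j)))"
        using i by (subst prod.permute[OF permutes_swap_id[of i _ "Suc i"]]) (auto simp: comp_def)
      also have "\<dots> = column_poly n (diagram_column (w \<circ> ?\<tau>) (?\<tau> i)) *
          (\<Prod>j\<in>{1..n} - {i}. column_poly n (diagram_column (w \<circ> ?\<tau>) (?\<tau> j)))"
        using i by (intro prod.remove) auto
      also have "(\<Prod>j\<in>{1..n} - {i}. column_poly n (diagram_column (w \<circ> ?\<tau>) (?\<tau> j))) =
          (\<Prod>j\<in>{1..n} - {i}. column_poly n (?\<tau> ` diagram_column w j))"
        using i by (intro prod.cong refl) (simp add: diagram_column_transpose)
      finally show ?thesis
        unfolding col_i .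
    qed
    have "schubert n w = div_diff i (schubert n (w \<circ> ?\<tau>))"
      unfolding schubert.simps[of n w] if_P[OF True] Let_def i_def ..
    also have "\<dots> = ?C i * (\<Prod>j\<in>{1..n} - {i}. ?C j)"
    proof (cases "\<exists>j\<in>{1..n} - {i}. Suc i \<in> diagram_column w j \<and> i \<notin> diagram_column w j")
      case False
      then have "(\<Prod>j\<in>{1..n} - {i}. column_poly n (?\<tau> ` diagram_column w j)) =
          (\<Prod>j\<in>{1..n} - {i}. ?C j)"
        using col_eq by (intro prod.cong refl) blast
      then have "schubert n (w \<circ> ?\<tau>) = pvar i * (?C i * (\<Prod>j\<in>{1..n} - {i}. ?C j))"
        unfolding IH by (simp add: mult.assoc)
      then show ?thesis
        by (simp add: div_diff_mult_symmetric div_diff_pvar sym)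
    next
      case True
      then obtain j where j: "j \<in> {1..n} - {i}" "Suc i \<in> diagram_column w j" "i \<notin> diagram_column w j"
        by blast
      let ?J = "{1..n} - {i} - {j}"
      have remove: "(\<Prod>j\<in>{1..n} - {i}. h j) = h j * (\<Prod>j\<in>?J. h j)" for h :: "nat \<Rightarrow> ipoly"
        using j(1) by (intro prod.remove) auto
      \<comment> \<open>Two such columns belong to positions right of \<open>Suc i\<close> with
        values strictly between \<open>w i\<close> and \<open>w (Suc i)\<close>; with
        \<open>i\<close> and \<open>Suc i\<close> they form a forbidden pattern.\<close>
      have "j' = j" if j': "j' \<in> {1..n} - {i}" "Suc i \<in> diagram_column w j'"
          "i \<notin> diagram_column w j'" for j'
      proof (rule ccontr)
        assume "j' \<noteq> j"
        have bounds: "w i < w x \<and> w x < w (Suc i) \<and> Suc i < x \<and> x \<le> n"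
          if "x \<in> {1..n} - {i}" "Suc i \<in> diagram_column w x" "i \<notin> diagram_column w x" for x
        proof -
          have "w x \<noteq> w i"
            using that \<open>inj w\<close> by (simp add: inj_eq)
          then show ?thesis
            using that i by (auto simp: diagram_column_def)
        qed
        have "\<not> (Suc i < x \<and> x < y \<and> y \<le> n \<and> w i < w x \<and> w i < w y \<and> w x < w (Suc i) \<and> w y < w (Suc i))"
          for x y
          using 1(3) i unfolding avoids_1432_1423_def by blast
        then show False
          using bounds[OF j] bounds[OF j'] \<open>j' \<noteq> j\<close> by (metis linorder_neqE_nat)
      qed
      then have "(\<Prod>j\<in>?J. column_poly n (?\<tau> ` diagram_column w j)) = (\<Prod>j\<in>?J. ?C j)"
        using col_eq by (intro prod.cong refl) blast
      then have "schubert n (w \<circ> ?\<tau>) =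
          pvar i * column_poly n (?\<tau> ` diagram_column w j) * (?C i * (\<Prod>j\<in>?J. ?C j))"
        unfolding IH remove by (simp add: ac_simps)
      then have "div_diff i (schubert n (w \<circ> ?\<tau>)) = ?C j * (?C i * (\<Prod>j\<in>?J. ?C j))"
        using j i by (simp add: div_diff_mult_symmetric div_diff_column_poly sym)
      then show ?thesis
        unfolding remove by (simp add: ac_simps)
    qed
    also have "\<dots> = (\<Prod>j\<in>{1..n}. ?C j)"
      using i by (intro prod.remove[symmetric]) auto
    finally show ?thesis .
  qed
qed


section \<open>Counting raised diagrams\<close>

text \<open>A subset \<open>R\<close> of the rows is encoded by its symmetric difference \<open>C\<close> with the diagram column
  \<open>j\<close>; the empty set encodes the column itself, whatever the ambient positions are.\<close>

definition raising_column :: "(nat \<Rightarrow> nat) \<Rightarrow> nat \<Rightarrow> nat set \<Rightarrow> bool" where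
  "raising_column w j C \<longleftrightarrow> C \<subseteq> {..<j} \<and>
     card {k \<in> C. w j < w k} = card {k \<in> C. w k < w j} \<and>
     (\<forall>p\<in>C. card {k \<in> C. k \<le> p \<and> w j < w k} \<le> card {k \<in> C. k \<le> p \<and> w k < w j})"

definition raising :: "(nat \<Rightarrow> nat) \<Rightarrow> (nat \<times> nat) set \<Rightarrow> bool" where
  "raising w S \<longleftrightarrow> (\<forall>j. raising_column w j {k. (k, j) \<in> S})"

text \<open>\<open>Field S = I\<close> demands that every position in \<open>I\<close> occur as a
  row or as a column, and no other position.\<close>

definition raising_count :: "(nat \<Rightarrow> nat) \<Rightarrow> nat set \<Rightarrow> nat" where
  "raising_count w I = card {S. raising w S \<and> Field S = I}"

lemma raising_column_empty [simp]: "raising_column w j {}"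
  by (simp add: raising_column_def)

text \<open>Passing from \<open>D\<close> to the symmetric difference loses
  \<open>C \<inter> D\<close> and gains \<open>C - D\<close>; the additive form avoids truncated
  subtraction.\<close>

lemma card_sym_diff_Int:
  assumes "finite C" "finite D"
  shows "card (sym_diff C D \<inter> P) + card (C \<inter> D \<inter> P) = card (D \<inter> P) + card ((C - D) \<inter> P)"
proof -
  have "card (sym_diff C D \<inter> P) = card ((C - D) \<inter> P) + card ((D - C) \<inter> P)"
    using assms by (subst card_Un_disjoint[symmetric]) (auto intro: arg_cong[where f = card])
  moreover have "card (D \<inter> P) = card ((D - C) \<inter> P) + card (C \<inter> D \<inter> P)"
    using assms by (subst card_Un_disjoint[symmetric]) (auto intro: arg_cong[where f = card])
  ultimately show ?thesis
    by simp
qed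

text \<open>Toggling the rows in \<open>C\<close> removes boxes where \<open>w j < w k\<close> and
  adds boxes where \<open>w k < w j\<close>. Domination says that additions outweigh or balance
  removals in each prefix, with equality overall.\<close>

lemma dominates_sym_diff_iff:
  assumes w: "inj w" and C: "C \<subseteq> {1..<j}"
  shows "dominates (sym_diff C (diagram_column w j)) (diagram_column w j) \<longleftrightarrow> raising_column w j C"
proof -
  let ?D = "diagram_column w j"
  have fin: "finite C" "finite ?D"
    using C by (auto simp: diagram_column_def intro: finite_subset)
  have down: "C \<inter> ?D \<inter> P = {k \<in> C. k \<in> P \<and> w j < w k}" for P
    using C by (auto simp: diagram_column_def)
  have "w k < w j \<longleftrightarrow> k \<notin> ?D" if "k \<in> C" for k
  proof -
    have "w k \<noteq> w j" "1 \<le> k" "k < j"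
      using C w that by (auto simp: inj_eq)
    then show ?thesis
      by (auto simp: diagram_column_def)
  qed
  then have up: "(C - ?D) \<inter> P = {k \<in> C. k \<in> P \<and> w k < w j}" for P
    by blast
  note cnt = card_sym_diff_Int[OF fin, unfolded up down]
  let ?le = "\<lambda>p. card {k \<in> C. k \<le> p \<and> w j < w k} \<le> card {k \<in> C. k \<le> p \<and> w k < w j}"
  \<comment> \<open>The counts change only at elements of \<open>C\<close>, so the bound at
    \<open>p\<close> is the one at the largest element of \<open>C\<close> up to \<open>p\<close>.
    Testing inside \<open>C\<close> alone is what frees the condition from the ambient
    positions.\<close>
  have extend: "?le p" if le: "\<forall>p\<in>C. ?le p" for p
  proof (cases "C \<inter> {..p} = {}")
    case True
    then have "{k \<in> C. k \<le> p \<and> w j < w k} = {}"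
      by auto
    then show ?thesis
      by (metis card.empty le0)
  next
    case False
    define q where "q = Max (C \<inter> {..p})"
    have "q \<in> C \<inter> {..p}"
      unfolding q_def using fin False by (intro Max_in) auto
    moreover have "k \<le> q" if "k \<in> C" "k \<le> p" for k
      unfolding q_def using fin that by (intro Max_ge) auto
    ultimately have q: "q \<in> C" and eq: "{k \<in> C. k \<le> p \<and> Q k} = {k \<in> C. k \<le> q \<and> Q k}" for Q
      by auto
    show ?thesis
      unfolding eq using le q by blast
  qed
  have prefix: "card (?D \<inter> {..p}) \<le> card (sym_diff C ?D \<inter> {..p}) \<longleftrightarrow> ?le p" for p
    using cnt[of "{..p}"] unfolding atMost_iff by linarith
  have total: "card (sym_diff C ?D) = card ?D \<longleftrightarrow>
      card {k \<in> C. w j < w k} = card {k \<in> C. w k < w j}"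
    using cnt[of UNIV] by auto
  have "C \<subseteq> {..<j}"
    using C by auto
  then show ?thesis
    unfolding dominates_def raising_column_def prefix total using extend by blast
qed

lemma card_dominates_eq:
  assumes w: "inj w" and j: "j \<in> {1..n}"
  shows "card {R. R \<subseteq> {1..n} \<and> dominates R (diagram_column w j)} =
    card {C. C \<subseteq> {1..n} \<and> raising_column w j C}"
proof -
  let ?D = "diagram_column w j"
  have D: "?D \<subseteq> {1..<j}"
    by (auto simp: diagram_column_def)
  \<comment> \<open>All boxes of \<open>?D\<close> lie above row \<open>j\<close>, so the prefix of
    \<open>R\<close> up to \<open>j - 1\<close> already has as many elements as \<open>R\<close>
    itself.\<close>
  have below: "R \<subseteq> {1..<j}" if R: "R \<subseteq> {1..n}" "dominates R ?D" for R
  proof -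
    have "finite R"
      using R by (auto intro: finite_subset)
    moreover have "?D \<inter> {..j - 1} = ?D"
      using D by fastforce
    then have "card R \<le> card (R \<inter> {..j - 1})"
      using R(2) unfolding dominates_def by metis
    ultimately have "R \<inter> {..j - 1} = R"
      by (intro card_seteq) auto
    then show ?thesis
      using R j by fastforce
  qed
  have invol: "sym_diff (sym_diff X ?D) ?D = X" for X
    by auto
  have "bij_betw (\<lambda>X. sym_diff X ?D)
      {R. R \<subseteq> {1..n} \<and> dominates R ?D} {C. C \<subseteq> {1..n} \<and> raising_column w j C}"
  proof (rule bij_betw_byWitness[where f' = "\<lambda>X. sym_diff X ?D"])
    show "(\<lambda>X. sym_diff X ?D) ` {R. R \<subseteq> {1..n} \<and> dominates R ?D}
        \<subseteq> {C. C \<subseteq> {1..n} \<and> raising_column w j C}"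
    proof clarify
      fix R assume R: "R \<subseteq> {1..n}" "dominates R ?D"
      have "sym_diff R ?D \<subseteq> {1..<j}"
        using below[OF R] D by auto
      then have "raising_column w j (sym_diff R ?D)"
        using dominates_sym_diff_iff[OF w, of "sym_diff R ?D" j] R(2) invol[of R] by simp
      moreover have "sym_diff R ?D \<subseteq> {1..n}"
        using R D j by fastforce
      ultimately show "sym_diff R ?D \<subseteq> {1..n} \<and> raising_column w j (sym_diff R ?D)"
        by blast
    qed
    show "(\<lambda>X. sym_diff X ?D) ` {C. C \<subseteq> {1..n} \<and> raising_column w j C}
        \<subseteq> {R. R \<subseteq> {1..n} \<and> dominates R ?D}"
    proof clarify
      fix C assume C: "C \<subseteq> {1..n}" "raising_column w j C"
      then have "C \<subseteq> {1..<j}"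
        by (fastforce simp: raising_column_def)
      then have "dominates (sym_diff C ?D) ?D"
        using dominates_sym_diff_iff[OF w] C(2) by blast
      moreover have "sym_diff C ?D \<subseteq> {1..n}"
        using C D j by fastforce
      ultimately show "sym_diff C ?D \<subseteq> {1..n} \<and> dominates (sym_diff C ?D) ?D"
        by blast
    qed
  qed (use invol in auto)
  then show ?thesis
    by (rule bij_betw_same_card)
qed

section \<open>Independence of the columns, and grouping by the positions involved\<close>

lemma card_raising:
  "card {S. S \<subseteq> {1..n} \<times> {1..n} \<and> raising w S} =
    (\<Prod>j\<in>{1..n}. card {C. C \<subseteq> {1..n} \<and> raising_column w j C})"
proof -
  let ?F = "PiE {1..n} (\<lambda>j. {C. C \<subseteq> {1..n} \<and> raising_column w j C})"
  let ?rel = "\<lambda>F. {(k, j). j \<in> {1..n} \<and> k \<in> F j}"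
  let ?cols = "\<lambda>S. \<lambda>j\<in>{1..n}. {k. (k, j) \<in> S}"
  have "bij_betw ?rel ?F {S. S \<subseteq> {1..n} \<times> {1..n} \<and> raising w S}"
  proof (rule bij_betw_byWitness[where f' = ?cols])
    show "\<forall>F\<in>?F. ?cols (?rel F) = F"
      by (auto simp: PiE_iff extensional_def fun_eq_iff)
    show "\<forall>S\<in>{S. S \<subseteq> {1..n} \<times> {1..n} \<and> raising w S}. ?rel (?cols S) = S"
      by auto
    show "?rel ` ?F \<subseteq> {S. S \<subseteq> {1..n} \<times> {1..n} \<and> raising w S}"
    proof clarify
      fix F assume F: "F \<in> ?F"
      have "raising_column w j {k. (k, j) \<in> ?rel F}" for j
        using F by (cases "j \<in> {1..n}") auto
      moreover have "?rel F \<subseteq> {1..n} \<times> {1..n}"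
        using PiE_mem[OF F] by blast
      ultimately show "?rel F \<subseteq> {1..n} \<times> {1..n} \<and> raising w (?rel F)"
        by (simp add: raising_def)
    qed
    show "?cols ` {S. S \<subseteq> {1..n} \<times> {1..n} \<and> raising w S} \<subseteq> ?F"
      by (auto simp: raising_def)
  qed
  from bij_betw_same_card[OF this] show ?thesis
    by (simp add: card_PiE)
qed

lemma peval_schubert_eq_card_raising:
  assumes "inj w" "avoids_1432_1423 n w"
  shows "peval (\<lambda>_. 1) (schubert n w) =
    int (card {S. S \<subseteq> {1..n} \<times> {1..n} \<and> raising w S})"
proof -
  have "peval (\<lambda>_. 1) (schubert n w) =
      (\<Prod>j\<in>{1..n}. int (card {R. R \<subseteq> {1..n} \<and> dominates R (diagram_column w j)}))"
    unfolding schubert_eq_prod_column_poly[OF assms]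
    by (simp add: peval_one_prod peval_one_sum peval_one_pvar column_poly_def)
  also have "\<dots> = (\<Prod>j\<in>{1..n}. int (card {C. C \<subseteq> {1..n} \<and> raising_column w j C}))"
    by (intro prod.cong refl) (simp only: card_dominates_eq[OF assms(1)])
  also have "\<dots> = int (card {S. S \<subseteq> {1..n} \<times> {1..n} \<and> raising w S})"
    unfolding card_raising of_nat_prod ..
  finally show ?thesis .
qed

lemma card_raising_eq_sum:
  "card {S. S \<subseteq> {1..n} \<times> {1..n} \<and> raising w S} = (\<Sum>I\<in>Pow {1..n}. raising_count w I)"
proof -
  let ?A = "{S. S \<subseteq> {1..n} \<times> {1..n} \<and> raising w S}"
  have fin: "finite ?A"
    by (rule finite_subset[of _ "Pow ({1..n} \<times> {1..n})"]) auto
  have Field: "S \<subseteq> {1..n} \<times> {1..n} \<longleftrightarrow> Field S \<in> Pow {1..n}" for S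
    by (auto simp: Field_def)
  have "Field ` ?A \<subseteq> Pow {1..n}"
    using Field by blast
  then have "card ?A = (\<Sum>I\<in>Pow {1..n}. card {S \<in> ?A. Field S = I})"
    using sum.group[OF fin, of "Pow {1..n}" Field "\<lambda>_. 1::nat"] by simp
  also have "\<dots> = (\<Sum>I\<in>Pow {1..n}. raising_count w I)"
    unfolding raising_count_def
    by (intro sum.cong refl arg_cong[where f = card]) (use Field in blast)
  finally show ?thesis .
qed

text \<open>The unchanged diagram accounts for the 1 subtracted in \<open>c_coeff\<close>.\<close>

lemma raising_count_empty: "raising_count w {} = 1"
proof -
  have "{S. raising w S \<and> Field S = {}} = {{}}"
    by (auto simp: raising_def Field_def)
  then show ?thesis
    by (simp add: raising_count_def)
qed


section \<open>Restriction to pattern occurrences\<close>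

text \<open>The embedding \<open>f\<close> is made explicit so that raisings can be transported
  along it.\<close>

definition is_occurrence :: "(nat \<Rightarrow> nat) \<Rightarrow> (nat \<Rightarrow> nat) \<Rightarrow> nat \<Rightarrow> (nat \<Rightarrow> nat) \<Rightarrow> nat set \<Rightarrow> bool" where
  "is_occurrence w f m u I \<longleftrightarrow> strict_mono_on {1..m} f \<and> f ` {1..m} = I \<and>
     (\<forall>a\<in>{1..m}. \<forall>b\<in>{1..m}. w (f a) < w (f b) \<longleftrightarrow> u a < u b)"

lemma pattern_count_eq_card_occurrences:
  "pattern_count m u n w = card {I. I \<subseteq> {1..n} \<and> (\<exists>f. is_occurrence w f m u I)}"
  by (simp add: pattern_count_def is_occurrence_def)

text \<open>\<open>raising_column\<close> only compares positions and values within \<open>C\<close>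
  and \<open>j\<close>, and \<open>f\<close> preserves and reflects both orders.\<close>

lemma raising_column_occurrence:
  assumes occ: "is_occurrence w f m u I" and j: "j \<in> {1..m}" and C: "C \<subseteq> {1..m}"
  shows "raising_column w (f j) (f ` C) \<longleftrightarrow> raising_column u j C"
proof -
  have less: "f a < f b \<longleftrightarrow> a < b" and le: "f a \<le> f b \<longleftrightarrow> a \<le> b"
    if "a \<in> {1..m}" "b \<in> {1..m}" for a b
    using occ that strict_mono_on_less strict_mono_on_less_eq
    unfolding is_occurrence_def by blast+
  have w: "w (f a) < w (f b) \<longleftrightarrow> u a < u b" if "a \<in> {1..m}" "b \<in> {1..m}" for a b
    using occ that by (auto simp: is_occurrence_def)
  have inj: "inj_on f C"
    using occ C by (auto simp: is_occurrence_def intro: inj_on_subset strict_mono_on_imp_inj_on)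
  have card_eq: "card {k \<in> f ` C. P k} = card {k \<in> C. Q k}"
    if "\<And>k. k \<in> C \<Longrightarrow> P (f k) \<longleftrightarrow> Q k" for P Q
  proof -
    have "{k \<in> f ` C. P k} = f ` {k \<in> C. Q k}"
      using that by auto
    then show ?thesis
      using inj by (simp add: card_image inj_on_subset)
  qed
  have mem: "k \<in> {1..m}" if "k \<in> C" for k
    using C that by blast
  have "card {k \<in> f ` C. w (f j) < w k} = card {k \<in> C. u j < u k}"
      "card {k \<in> f ` C. w k < w (f j)} = card {k \<in> C. u k < u j}"
    by (intro card_eq w j mem; assumption)+
  moreover have "card {k \<in> f ` C. k \<le> f p \<and> w (f j) < w k} = card {k \<in> C. k \<le> p \<and> u j < u k}"
      "card {k \<in> f ` C. k \<le> f p \<and> w k < w (f j)} = card {k \<in> C. k \<le> p \<and> u k < u j}"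
    if "p \<in> C" for p
    by (intro card_eq conj_cong w le j mem that; assumption)+
  moreover have "f ` C \<subseteq> {..<f j} \<longleftrightarrow> C \<subseteq> {..<j}"
    using less[OF mem j] by auto
  ultimately show ?thesis
    unfolding raising_column_def by auto
qed

lemma raising_occurrence:
  assumes occ: "is_occurrence w f m u I" and S: "S \<subseteq> {1..m} \<times> {1..m}"
  shows "raising w (map_prod f f ` S) \<longleftrightarrow> raising u S"
proof -
  have inj: "inj_on f {1..m}"
    using occ by (auto simp: is_occurrence_def intro: strict_mono_on_imp_inj_on)
  have col: "{k. (k, f j) \<in> map_prod f f ` S} = f ` {k. (k, j) \<in> S}" if "j \<in> {1..m}" for j
    using S that inj_onD[OF inj] by (force simp: image_iff)
  have sub: "{k. (k, j) \<in> S} \<subseteq> {1..m}" for j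
    using S by auto
  \<comment> \<open>Columns off the image are empty and so satisfy \<open>raising_column\<close>
    trivially; only the columns \<open>f j\<close> remain to be checked.\<close>
  have outside: "{k. (k, j) \<in> map_prod f f ` S} = {}" if "j \<notin> f ` {1..m}" for j
    using S that by auto
  have outside': "{k. (k, j) \<in> S} = {}" if "j \<notin> {1..m}" for j
    using S that by auto
  have "raising w (map_prod f f ` S) \<longleftrightarrow>
      (\<forall>j\<in>f ` {1..m}. raising_column w j {k. (k, j) \<in> map_prod f f ` S})"
    unfolding raising_def using outside by (metis raising_column_empty)
  also have "\<dots> \<longleftrightarrow> (\<forall>j\<in>{1..m}. raising_column u j {k. (k, j) \<in> S})"
    using col raising_column_occurrence[OF occ _ sub] by auto
  also have "\<dots> \<longleftrightarrow> raising u S"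
    unfolding raising_def using outside' by (metis raising_column_empty)
  finally show ?thesis .
qed

text \<open>Taking images under \<open>map_prod f f\<close> is a bijection between the two families
  of raisings.\<close>

lemma raising_count_occurrence:
  assumes occ: "is_occurrence w f m u I"
  shows "raising_count w I = raising_count u {1..m}"
proof -
  have inj: "inj_on f {1..m}" and I: "I = f ` {1..m}"
    using occ by (auto simp: is_occurrence_def intro: strict_mono_on_imp_inj_on)
  have Field_map: "Field (map_prod f f ` S) = f ` Field S" for S
    by (force simp: Field_def)
  have sub: "S \<subseteq> {1..m} \<times> {1..m}" if "Field S = {1..m}" for S
    using that by (auto simp: Field_def)
  have "inj_on (image (map_prod f f)) (Pow ({1..m} \<times> {1..m}))"
    by (intro inj_on_image_Pow map_prod_inj_on inj)
  then have "inj_on (image (map_prod f f)) {S. raising u S \<and> Field S = {1..m}}"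
    by (rule inj_on_subset) (use sub in auto)
  moreover have "image (map_prod f f) ` {S. raising u S \<and> Field S = {1..m}} =
      {S. raising w S \<and> Field S = I}"
  proof (intro equalityI subsetI)
    fix T assume "T \<in> image (map_prod f f) ` {S. raising u S \<and> Field S = {1..m}}"
    then show "T \<in> {S. raising w S \<and> Field S = I}"
      using raising_occurrence[OF occ sub] I by (auto simp: Field_map)
  next
    fix T assume T: "T \<in> {S. raising w S \<and> Field S = I}"
    then have "T \<subseteq> map_prod f f ` ({1..m} \<times> {1..m})"
      unfolding map_prod_surj_on[OF I[symmetric] I[symmetric]] by (auto simp: Field_def)
    then obtain S where S: "S \<subseteq> {1..m} \<times> {1..m}" and T_eq: "T = map_prod f f ` S"
      by (auto simp: subset_image_iff)
    have "f ` Field S = f ` {1..m}"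
      using T unfolding T_eq I by (simp add: Field_map)
    moreover have "Field S \<subseteq> {1..m}"
      using S by (auto simp: Field_def)
    ultimately have "Field S = {1..m}"
      using inj_on_image_eq_iff[OF inj] by blast
    then show "T \<in> image (map_prod f f) ` {S. raising u S \<and> Field S = {1..m}}"
      using T raising_occurrence[OF occ S] by (auto simp: T_eq)
  qed
  ultimately have "bij_betw (image (map_prod f f))
      {S. raising u S \<and> Field S = {1..m}} {S. raising w S \<and> Field S = I}"
    by (simp only: bij_betw_def)
  from bij_betw_same_card[OF this] show ?thesis
    by (simp only: raising_count_def)
qed

lemma avoids_1432_1423_occurrence:
  assumes "avoids_1432_1423 n w" "is_occurrence w f m u I" "I \<subseteq> {1..n}"
  shows "avoids_1432_1423 m u"
  unfolding avoids_1432_1423_def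
proof (intro allI impI notI)
  fix a b c d
  assume ord: "1 \<le> a \<and> a < b \<and> b < c \<and> c < d \<and> d \<le> m"
  then have mem: "a \<in> {1..m}" "b \<in> {1..m}" "c \<in> {1..m}" "d \<in> {1..m}"
    by auto
  have "1 \<le> f a" "f d \<le> n"
    using assms(2,3) mem unfolding is_occurrence_def by (meson atLeastAtMost_iff imageI subsetD)+
  moreover have "f a < f b" "f b < f c" "f c < f d"
    using assms(2) mem ord unfolding is_occurrence_def strict_mono_on_def by blast+
  moreover assume "u a < u c \<and> u a < u d \<and> u c < u b \<and> u d < u b"
  then have "w (f a) < w (f c) \<and> w (f a) < w (f d) \<and> w (f c) < w (f b) \<and> w (f d) < w (f b)"
    using assms(2) mem unfolding is_occurrence_def by simp
  ultimately show False
    using assms(1)[unfolded avoids_1432_1423_def, rule_format, of "f a" "f b" "f c" "f d"] by simp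
qed

section \<open>Each index set carries exactly one pattern\<close>

lemma rank_less_iff:
  fixes v :: "'a \<Rightarrow> nat"
  assumes "finite A" "a \<in> A" "b \<in> A"
  shows "card {c \<in> A. v c \<le> v a} < card {c \<in> A. v c \<le> v b} \<longleftrightarrow> v a < v b"
proof
  assume "v a < v b"
  then have "{c \<in> A. v c \<le> v a} \<subset> {c \<in> A. v c \<le> v b}"
    using assms by force
  then show "card {c \<in> A. v c \<le> v a} < card {c \<in> A. v c \<le> v b}"
    using assms by (intro psubset_card_mono) auto
next
  assume "card {c \<in> A. v c \<le> v a} < card {c \<in> A. v c \<le> v b}"
  then show "v a < v b"
    using assms card_mono[of "{c \<in> A. v c \<le> v a}" "{c \<in> A. v c \<le> v b}"] by fastforce
qed

text \<open>Standardization: \<open>u\<close> lists the ranks of the values of \<open>w\<close>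
  along the increasing enumeration of \<open>I\<close>.\<close>

lemma ex_occurrence:
  assumes w: "inj w" and I: "finite I" "card I = m"
  shows "\<exists>u f. u permutes {1..m} \<and> is_occurrence w f m u I"
proof -
  obtain h where h: "bij_betw h {..<m} I" "strict_mono_on {..<m} h"
    using ex_bij_betw_strict_mono_card[OF I(1)] I(2) by metis
  \<comment> \<open>Shifts an enumeration starting at 0 to positions starting at 1.\<close>
  define f where "f a = h (a - 1)" for a
  have mono: "strict_mono_on {1..m} f"
    by (rule strict_mono_onI) (auto simp: f_def intro!: strict_mono_onD[OF h(2)])
  have img: "f ` {1..m} = I"
  proof -
    have "(\<lambda>a. a - 1) ` {1..m} = {..<m}"
      by (force simp: image_iff intro: bexI[of _ "Suc _"])
    then show ?thesis
      using h(1) unfolding f_def bij_betw_def by (metis image_image)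
  qed
  have inj: "inj_on f {1..m}"
    using mono by (rule strict_mono_on_imp_inj_on)
  let ?rank = "\<lambda>a. card {b \<in> {1..m}. w (f b) \<le> w (f a)}"
  \<comment> \<open>Outside \<open>{1..m}\<close> the identity is required by
    \<open>permutes\<close>.\<close>
  define u where "u a = (if a \<in> {1..m} then ?rank a else a)" for a
  have order: "u a < u b \<longleftrightarrow> w (f a) < w (f b)" if "a \<in> {1..m}" "b \<in> {1..m}" for a b
    using rank_less_iff[OF _ that, of "\<lambda>a. w (f a)"] that by (simp add: u_def)
  have "inj_on u {1..m}"
  proof (rule inj_onI)
    fix a b assume ab: "a \<in> {1..m}" "b \<in> {1..m}" "u a = u b"
    then have "w (f a) = w (f b)"
      using order[of a b] order[of b a] by auto
    then show "a = b"
      using ab inj w by (simp add: inj_eq inj_on_eq_iff)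
  qed
  moreover have "u ` {1..m} \<subseteq> {1..m}"
  proof clarify
    fix a assume a: "a \<in> {1..m}"
    have "?rank a \<le> card {1..m}"
      by (intro card_mono) auto
    moreover have "0 < ?rank a"
      using a by (subst card_gt_0_iff) auto
    ultimately show "u a \<in> {1..m}"
      using a by (simp add: u_def)
  qed
  ultimately have "bij_betw u {1..m} {1..m}"
    by (simp add: bij_betw_def endo_inj_surj)
  then have "u permutes {1..m}"
    by (rule bij_imp_permutes) (simp only: u_def if_False)
  moreover have "is_occurrence w f m u I"
    using mono img order by (simp add: is_occurrence_def)
  ultimately show ?thesis
    by blast
qed

text \<open>Shows that the embedding is determined by its image \<open>I\<close>.\<close>

lemma occurrence_embedding_rank:
  fixes f :: "nat \<Rightarrow> nat"
  assumes "strict_mono_on {1..m} f" "f ` {1..m} = I" "a \<in> {1..m}"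
  shows "card {x \<in> I. x \<le> f a} = a"
proof -
  have "f b \<le> f a \<longleftrightarrow> b \<le> a" if "b \<in> {1..m}" for b
    using strict_mono_on_less_eq[OF assms(1) that assms(3)] .
  then have "{x \<in> I. x \<le> f a} = f ` {b \<in> {1..m}. b \<le> a}"
    unfolding assms(2)[symmetric] by blast
  also have "{b \<in> {1..m}. b \<le> a} = {1..a}"
    using assms(3) by auto
  finally have "{x \<in> I. x \<le> f a} = f ` {1..a}" .
  moreover have "inj_on f {1..a}"
    using strict_mono_on_imp_inj_on[OF assms(1)] by (rule inj_on_subset) (use assms(3) in auto)
  ultimately show ?thesis
    by (simp add: card_image)
qed

text \<open>Shows that a permutation is determined by the comparisons between its values.\<close>

lemma permutes_rank:
  fixes u :: "nat \<Rightarrow> nat"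
  assumes "u permutes {1..m}" "a \<in> {1..m}"
  shows "card {b \<in> {1..m}. u b \<le> u a} = u a"
proof -
  have "u ` {b \<in> {1..m}. u b \<le> u a} = {1..u a}"
  proof (intro equalityI subsetI)
    fix x assume "x \<in> {1..u a}"
    moreover have "u a \<in> {1..m}"
      using assms permutes_in_image[OF assms(1)] by simp
    ultimately have "x \<in> u ` {1..m}"
      unfolding permutes_image[OF assms(1)] by simp
    then show "x \<in> u ` {b \<in> {1..m}. u b \<le> u a}"
      using \<open>x \<in> {1..u a}\<close> by auto
  next
    fix x assume "x \<in> u ` {b \<in> {1..m}. u b \<le> u a}"
    then obtain b where "x = u b" "b \<in> {1..m}" "u b \<le> u a"
      by blast
    then show "x \<in> {1..u a}"
      using permutes_in_image[OF assms(1), of b] by simp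
  qed
  moreover have "inj_on u {b \<in> {1..m}. u b \<le> u a}"
    using permutes_inj[OF assms(1)] by (rule inj_on_subset) simp
  note card_image[OF this]
  ultimately show ?thesis
    by simp
qed

text \<open>\<open>I\<close> determines the embedding, the embedding determines all comparisons, and
  these determine the permutation.\<close>

lemma occurrence_unique:
  assumes u: "u permutes {1..m}" "is_occurrence w f m u I"
    and v: "v permutes {1..m}" "is_occurrence w g m v I"
  shows "u = v"
proof -
  have fg: "f a = g a" if a: "a \<in> {1..m}" for a
  proof -
    have "f a \<in> g ` {1..m}"
      using a u(2) v(2) by (auto simp: is_occurrence_def)
    then obtain b where b: "b \<in> {1..m}" "f a = g b"
      by auto
    then have "a = b"
      using occurrence_embedding_rank[of m f I a] occurrence_embedding_rank[of m g I b] a u(2) v(2)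
      by (simp add: is_occurrence_def)
    then show ?thesis
      using b by simp
  qed
  have "u a = v a" for a
  proof (cases "a \<in> {1..m}")
    case True
    have "u a < u b \<longleftrightarrow> v a < v b" if "b \<in> {1..m}" for b
    proof -
      have "u a < u b \<longleftrightarrow> w (f a) < w (f b)"
        using u(2) True that unfolding is_occurrence_def by blast
      also have "\<dots> \<longleftrightarrow> w (g a) < w (g b)"
        by (simp only: fg[OF True] fg[OF that])
      also have "\<dots> \<longleftrightarrow> v a < v b"
        using v(2) True that unfolding is_occurrence_def by blast
      finally show ?thesis .
    qed
    then have "u b \<le> u a \<longleftrightarrow> v b \<le> v a" if "b \<in> {1..m}" for b
      using that by (simp flip: not_less)
    then have "{b \<in> {1..m}. u b \<le> u a} = {b \<in> {1..m}. v b \<le> v a}"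
      by blast
    then show ?thesis
      using permutes_rank[OF u(1) True] permutes_rank[OF v(1) True] by simp
  next
    case False
    then show ?thesis
      using u(1) v(1) by (simp add: permutes_not_in)
  qed
  then show ?thesis
    by blast
qed

text \<open>The two patterns differ only in the order of the last two entries, which are distinct by
  injectivity.\<close>

lemma avoids_1432_1423I:
  assumes "avoids n w [1, 4, 3, 2]" "avoids n w [1, 4, 2, 3]" "inj w"
  shows "avoids_1432_1423 n w"
  unfolding avoids_1432_1423_def
proof (intro allI impI notI)
  fix a b c d
  assume ord: "1 \<le> a \<and> a < b \<and> b < c \<and> c < d \<and> d \<le> n"
    and pat: "w a < w c \<and> w a < w d \<and> w c < w b \<and> w d < w b"
  define f where "f i = [a, b, c, d] ! (i - 1)" for i
  have f: "f (Suc 0) = a" "f 2 = b" "f 3 = c" "f 4 = d"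
    by (simp_all add: f_def)
  have set4: "{1..4} = {Suc 0, 2, 3, 4}"
    by auto
  have "strict_mono_on {1..4} f"
    unfolding set4 by (rule strict_mono_onI) (use ord in \<open>auto simp: f\<close>)
  then have occ: "is_occurrence w f 4 u (f ` {1..4})"
    if "\<forall>i\<in>{1..4}. \<forall>j\<in>{1..4}. w (f i) < w (f j) \<longleftrightarrow> u i < u j" for u
    using that by (simp only: is_occurrence_def)
  have sub: "f ` {1..4} \<subseteq> {1..n}"
    using ord unfolding set4 by (auto simp: f)
  have none: "\<not> is_occurrence w f 4 (one_line xs) (f ` {1..4})"
    if "avoids n w xs" "length xs = 4" for xs
  proof -
    have "finite {I. I \<subseteq> {1..n} \<and> (\<exists>f. is_occurrence w f 4 (one_line xs) I)}"
      by (rule finite_subset[of _ "Pow {1..n}"]) auto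
    then show ?thesis
      using that sub unfolding avoids_def pattern_count_eq_card_occurrences by auto
  qed
  have "w c \<noteq> w d"
    using ord \<open>inj w\<close> by (auto simp: inj_eq)
  then consider "w c < w d" | "w d < w c"
    by linarith
  then show False
  proof cases
    case 1
    have "is_occurrence w f 4 (one_line [1, 4, 2, 3]) (f ` {1..4})"
      by (rule occ, unfold set4) (use pat 1 in \<open>simp add: f one_line_def\<close>)
    then show False
      using none[OF assms(2)] by simp
  next
    case 2
    have "is_occurrence w f 4 (one_line [1, 4, 3, 2]) (f ` {1..4})"
      by (rule occ, unfold set4) (use pat 2 in \<open>simp add: f one_line_def\<close>)
    then show False
      using none[OF assms(1)] by simp
  qed
qed

text \<open>All raisings are sorted by the set \<open>I\<close> they involve. By induction, the sets
  of size strictly between 0 and \<open>n\<close> contribute exactly the sum in the recursion of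
  \<open>c_coeff\<close>.\<close>

theorem c_coeff_eq_raising_count:
  assumes "n \<ge> 1" "w permutes {1..n}" "avoids_1432_1423 n w"
  shows "c_coeff n w = int (raising_count w {1..n})"
  using assms
proof (induction n arbitrary: w rule: less_induct)
  case (less n w)
  let ?r = "\<lambda>I. int (raising_count w I)"
  let ?\<I> = "\<lambda>m. {I \<in> Pow {1..n}. card I = m}"
  have inj: "inj w"
    using less.prems by (auto intro: permutes_inj)
  have level: "(\<Sum>u | u permutes {1..m}. c_coeff m u * int (pattern_count m u n w)) = sum ?r (?\<I> m)"
    if m: "m \<in> {1..<n}" for m
  proof -
    let ?occ = "\<lambda>u. {I. I \<subseteq> {1..n} \<and> (\<exists>f. is_occurrence w f m u I)}"
    \<comment> \<open>The induction hypothesis applies when \<open>u\<close> occurs in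
      \<open>w\<close>, since \<open>u\<close> then inherits the avoidance; otherwise both sides are
      0.\<close>
    have "c_coeff m u * int (pattern_count m u n w) = sum ?r (?occ u)" if u: "u permutes {1..m}" for u
    proof -
      have "?r I = c_coeff m u" if I: "I \<in> ?occ u" for I
      proof -
        obtain f where f: "is_occurrence w f m u I"
          using I by auto
        have "avoids_1432_1423 m u"
          using I less.prems by (intro avoids_1432_1423_occurrence[OF _ f]) auto
        then show ?thesis
          using less.IH[of m u] m u raising_count_occurrence[OF f] by simp
      qed
      then show ?thesis
        by (simp add: pattern_count_eq_card_occurrences)
    qed
    then have "(\<Sum>u | u permutes {1..m}. c_coeff m u * int (pattern_count m u n w)) =
        (\<Sum>u | u permutes {1..m}. sum ?r (?occ u))"
      by (intro sum.cong refl) simp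
    also have "\<dots> = sum ?r (\<Union>u\<in>{u. u permutes {1..m}}. ?occ u)"
    proof (rule sum.UNION_disjoint[symmetric])
      show "finite {u. u permutes {1..m}}"
        by (simp add: finite_permutations)
      show "\<forall>u\<in>{u. u permutes {1..m}}. finite (?occ u)"
        by (auto intro: finite_subset[of _ "Pow {1..n}"])
      show "\<forall>u\<in>{u. u permutes {1..m}}. \<forall>v\<in>{u. u permutes {1..m}}. u \<noteq> v \<longrightarrow> ?occ u \<inter> ?occ v = {}"
        using occurrence_unique by blast
    qed
    also have "(\<Union>u\<in>{u. u permutes {1..m}}. ?occ u) = ?\<I> m"
    proof (intro equalityI subsetI)
      fix I assume "I \<in> (\<Union>u\<in>{u. u permutes {1..m}}. ?occ u)"
      then show "I \<in> ?\<I> m"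
        by (auto simp: is_occurrence_def card_image strict_mono_on_imp_inj_on)
    next
      fix I assume "I \<in> ?\<I> m"
      then show "I \<in> (\<Union>u\<in>{u. u permutes {1..m}}. ?occ u)"
        using ex_occurrence[OF inj, of I m] by (auto intro: finite_subset)
    qed
    finally show ?thesis .
  qed
  have top: "?\<I> n = {{1..n}}"
    by (auto dest: card_subset_eq[rotated])
  have bot: "?\<I> 0 = {{}}"
    by (auto simp: card_eq_0_iff intro: finite_subset)
  have "peval (\<lambda>_. 1) (schubert n w) = sum ?r (Pow {1..n})"
    unfolding peval_schubert_eq_card_raising[OF inj less.prems(3)] card_raising_eq_sum of_nat_sum ..
  also have "\<dots> = (\<Sum>m\<in>{0..n}. sum ?r (?\<I> m))"
  proof (rule sum.group[symmetric])
    show "card ` Pow {1..n} \<subseteq> {0..n}"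
      using card_mono[of "{1..n}"] by fastforce
  qed auto
  \<comment> \<open>The sizes 0 and \<open>n\<close> lie outside the sum in \<open>c_coeff\<close>:
    they yield the constant 1 and the term sought.\<close>
  also have "{0..n} = insert 0 (insert n {1..<n})"
    using less.prems(1) by auto
  also have "(\<Sum>m\<in>insert 0 (insert n {1..<n}). sum ?r (?\<I> m)) =
      1 + ?r {1..n} + (\<Sum>m\<in>{1..<n}. sum ?r (?\<I> m))"
  proof -
    have "(\<Sum>m\<in>insert 0 (insert n {1..<n}). sum ?r (?\<I> m)) =
        sum ?r (?\<I> 0) + (sum ?r (?\<I> n) + (\<Sum>m\<in>{1..<n}. sum ?r (?\<I> m)))"
      using less.prems(1) by simp
    then show ?thesis
      unfolding top bot by (simp add: raising_count_empty)
  qed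
  also have "(\<Sum>m\<in>{1..<n}. sum ?r (?\<I> m)) =
      (\<Sum>m\<in>{1..<n}. \<Sum>u | u permutes {1..m}. c_coeff m u * int (pattern_count m u n w))"
    by (intro sum.cong refl level[symmetric])
  finally show ?case
    unfolding c_coeff.simps[of n w] by simp
qed

theorem theorem3p13:
  fixes n :: nat and w :: "nat \<Rightarrow> nat"
  assumes "n \<ge> 1"
    and "w permutes {1..n}"
    and "avoids n w [1, 4, 3, 2]"
    and "avoids n w [1, 4, 2, 3]"
  shows "c_coeff n w \<ge> 0"
  using assms by (simp add: c_coeff_eq_raising_count avoids_1432_1423I permutes_inj)

end
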